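(* Let $a,c$ be real numbers with $a, c, c-a$ not negative integers and with $c>a>0$, and let $0<\rho\le 1$. Let $f(z)={}_2F_1(a,1;c;z)$ for $|z|<1$, and for integers $m,n\ge 0$ with $m\ge n-1$ let $P_{mn}(z)/Q_{mn}(z)$ be the $[m/n]$ Padé approximant for $f$. Then $P_{mn}(z)/Q_{mn}(z)$ converges to ${}_2F_1(a,1;c;z)$ as $m\to\infty$, $n/m\to\rho$ (with $m\ge n-1$), uniformly in $z$ on compact subsets of the open unit disc $|z|<1$. That is, for every sequence $(m_j,n_j)_{j\ge 1}$ of pairs of nonnegative integers with $m_j\ge n_j-1$, $m_j\to\infty$ and $n_j/m_j\to\rho$, and for every compact set $K\subset\{z\in\mathbb{C}:|z|<1\}$, $$\sup_{z\in K}\left|\frac{P_{m_jn_j}(z)}{Q_{m_jn_j}(z)}-{}_2F_1(a,1;c;z)\right|\to 0\quad\text{as } j\to\infty.$$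
   Context: The Gauss hypergeometric function is ${}_2F_1(a,b;c;z)=\sum_{k\ge 0}\frac{(a)_k(b)_k}{(c)_k\,k!}z^k$ for $|z|<1$, where $(\alpha)_0=1$ and $(\alpha)_k=\alpha(\alpha+1)\cdots(\alpha+k-1)$. The $[m/n]$ Padé approximant for a power series $f(z)=\sum_{k\ge0}t_kz^k$ is the (unique) rational function $P_{mn}(z)/Q_{mn}(z)$, with $P_{mn}$, $Q_{mn}$ polynomials, $\deg P_{mn}\le m$, $\deg Q_{mn}\le n$, $Q_{mn}\not\equiv 0$, such that $f(z)Q_{mn}(z)-P_{mn}(z)=O(z^{m+n+1})$ as $z\to0$. For $f(z)={}_2F_1(a,1;c;z)$ and $m\ge n-1$ the denominator is normalized as $Q_{mn}(z)={}_2F_1(-n,-a-m;-c-m-n+1;z)=\sum_{k=0}^{n}\frac{(-n)_k(-a-m)_k}{(-c-m-n+1)_k\,k!}z^k$ (so $Q_{mn}(0)=1$), and $P_{mn}$ is then the polynomial formed by the terms of degree at most $m$ in the power series product $Q_{mn}(z)f(z)$. *)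

theory Defs
  imports "HOL-Analysis.Analysis" "HOL-Computational_Algebra.Computational_Algebra"
begin

definition hyp_2F1_fps :: "'a::field_char_0 \<Rightarrow> 'a \<Rightarrow> 'a \<Rightarrow> 'a fps" where
  "hyp_2F1_fps a b c = fps_hypergeo [a, b] [c] 1"

lemma hyp_2F1_fps_nth:
  "hyp_2F1_fps a b c $ k = pochhammer a k * pochhammer b k / (pochhammer c k * fact k)"
  by (simp add: hyp_2F1_fps_def)

definition hyp_2F1 :: "complex \<Rightarrow> complex \<Rightarrow> complex \<Rightarrow> complex \<Rightarrow> complex" where
  "hyp_2F1 a b c z = eval_fps (hyp_2F1_fps a b c) z"

(* The rational function P / Q is the [m/n] approximant of f. *)
definition is_pade :: "'a::field fps \<Rightarrow> nat \<Rightarrow> nat \<Rightarrow> 'a poly \<Rightarrow> 'a poly \<Rightarrow> bool" where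
  "is_pade f m n P Q \<longleftrightarrow>
     degree P \<le> m \<and> degree Q \<le> n \<and> Q \<noteq> 0 \<and>
     (\<forall>k\<le>m + n. (f * fps_of_poly Q - fps_of_poly P) $ k = 0)"

(* The sum stops at n explicitly: for integer c the lower parameter can be a negative
   integer, and the full series would contain meaningless terms of the form 0/0. *)
definition hyp_pade_denom :: "'a::field_char_0 \<Rightarrow> 'a \<Rightarrow> nat \<Rightarrow> nat \<Rightarrow> 'a poly" where
  "hyp_pade_denom a c m n =
     (\<Sum>k\<le>n. monom (pochhammer (- of_nat n) k * pochhammer (- a - of_nat m) k /
                    (pochhammer (- c - of_nat m - of_nat n + 1) k * fact k)) k)"

lemma coeff_hyp_pade_denom:
  "coeff (hyp_pade_denom a c m n) k =
     (if k \<le> n then pochhammer (- of_nat n) k * pochhammer (- a - of_nat m) k /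
                    (pochhammer (- c - of_nat m - of_nat n + 1) k * fact k) else 0)"
  by (simp add: hyp_pade_denom_def coeff_sum if_distrib sum.delta' cong: if_cong)

lemma coeff_0_hyp_pade_denom: "coeff (hyp_pade_denom a c m n) 0 = 1"
  by (simp add: coeff_hyp_pade_denom)

lemma degree_hyp_pade_denom: "degree (hyp_pade_denom a c m n) \<le> n"
  by (rule degree_le) (simp add: coeff_hyp_pade_denom)

lemma alternating_binomial_sum_poly_eq_0:
  fixes p :: "'a::field_char_0 poly"
  assumes "degree p < n"
  shows "(\<Sum>j\<le>n. (-1) ^ j * of_nat (n choose j) * poly p (of_nat j)) = 0"
  using assms
proof (induction n arbitrary: p)
  case 0
  then show ?case by simp
next
  case (Suc n)
  define q where "q = p - pcompose p [:1, 1:]"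
  have eq: "(\<Sum>j\<le>Suc n. (-1) ^ j * of_nat (Suc n choose j) * poly p (of_nat j)) =
        (\<Sum>j\<le>n. (-1) ^ j * of_nat (n choose j) * poly q (of_nat j))"
  proof -
    have "(\<Sum>j\<le>Suc n. (-1) ^ j * of_nat (Suc n choose j) * poly p (of_nat j)) =
      poly p 0 + (\<Sum>j\<le>n. (-1) ^ Suc j * (of_nat (n choose Suc j) + of_nat (n choose j))
                         * poly p (of_nat (Suc j)))"
      by (subst sum.atMost_Suc_shift) (simp add: add.commute)
    also have "\<dots> = (poly p 0 + (\<Sum>j\<le>n. (-1) ^ Suc j * of_nat (n choose Suc j) * poly p (of_nat (Suc j))))
        - (\<Sum>j\<le>n. (-1) ^ j * of_nat (n choose j) * poly p (of_nat (Suc j)))"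
      by (simp add: algebra_simps sum.distrib sum_negf sum_subtractf)
    also have "poly p 0 + (\<Sum>j\<le>n. (-1) ^ Suc j * of_nat (n choose Suc j) * poly p (of_nat (Suc j))) =
        (\<Sum>j\<le>Suc n. (-1) ^ j * of_nat (n choose j) * poly p (of_nat j))"
      by (subst sum.atMost_Suc_shift) simp
    also have "\<dots> = (\<Sum>j\<le>n. (-1) ^ j * of_nat (n choose j) * poly p (of_nat j))"
      by simp
    finally show ?thesis
      by (simp add: q_def poly_pcompose sum_subtractf right_diff_distrib add.commute)
  qed
  show ?case
  proof (cases "degree p = 0")
    case True
    then obtain x where "p = [:x:]" by (rule degree_eq_zeroE)
    then have "q = 0" by (simp add: q_def)
    then show ?thesis by (subst eq) simp
  next
    case False
    have "degree (pcompose p [:1, 1:]) = degree p" by (simp add: degree_pcompose)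
    moreover have "lead_coeff (pcompose p [:1, 1:]) = lead_coeff p"
      by (subst lead_coeff_comp) auto
    ultimately have "degree q < degree p"
      using False unfolding q_def
      by (intro degree_lessI) (auto simp: coeff_eq_0 le_less)
    then have "degree q < n" using Suc.prems by simp
    then show ?thesis by (subst eq) (rule Suc.IH)
  qed
qed

lemma pochhammer_minus_poly:
  fixes x :: "'a::field_char_0"
  obtains p where "degree p \<le> r" "\<And>y. poly p y = pochhammer (x - y) r"
proof
  show "degree (\<Prod>i<r. [:x + of_nat i, - 1:]) \<le> r"
    by (rule order.trans[OF degree_prod_sum_le]) auto
  show "poly (\<Prod>i<r. [:x + of_nat i, - 1:]) y = pochhammer (x - y) r" for y
    by (simp add: poly_prod pochhammer_prod atLeast0LessThan algebra_simps)
qed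

text \<open>
  The explicit denominator, with the truncated product as numerator, satisfies the defining
  conditions of the Pade approximant; hence requiring both the normalisation of the
  denominator and \<^const>\<open>is_pade\<close> is consistent, and it determines the pair uniquely.
\<close>

lemma is_pade_hyp_pade_denom:
  fixes a c :: "'a::field_char_0"
  assumes c: "\<And>k. pochhammer c k \<noteq> 0" and mn: "n \<le> m + 1"
  shows "is_pade (hyp_2F1_fps a 1 c) m n
           (truncate_fps (Suc m) (hyp_2F1_fps a 1 c * fps_of_poly (hyp_pade_denom a c m n)))
           (hyp_pade_denom a c m n)"
proof -
  let ?f = "hyp_2F1_fps a 1 c" and ?Q = "hyp_pade_denom a c m n"
  let ?P = "truncate_fps (Suc m) (?f * fps_of_poly ?Q)"
  have f_nth: "?f $ k = pochhammer a k / pochhammer c k" for k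
    by (simp add: hyp_2F1_fps_nth pochhammer_fact[symmetric])
  have zero: "(?f * fps_of_poly ?Q) $ k = 0" if k: "m < k" "k \<le> m + n" for k
  proof -
    obtain p1 where p1: "degree p1 \<le> k - m - 1"
      "\<And>y. poly p1 y = pochhammer (a + of_nat m + 1 - y) (k - m - 1)"
      using pochhammer_minus_poly by blast
    obtain p2 where p2: "degree p2 \<le> m + n - k"
      "\<And>y. poly p2 y = pochhammer (c + of_nat k - y) (m + n - k)"
      using pochhammer_minus_poly by blast
    define C where "C = pochhammer a (m + 1) / pochhammer c (m + n)"
    have summand: "coeff ?Q j * ?f $ (k - j) =
        C * ((-1) ^ j * of_nat (n choose j) * poly (p1 * p2) (of_nat j))" if j: "j \<le> n" for j
    proof -
      have "j \<le> m + 1" "j \<le> k" using j mn k by auto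
      have a1: "pochhammer (- a - of_nat m) j = (-1) ^ j * pochhammer (a + of_nat m + 1 - of_nat j) j"
        using pochhammer_minus[of "a + of_nat m" j] by (simp add: algebra_simps)
      have a2: "pochhammer a (k - j) =
          pochhammer a (m + 1 - j) * pochhammer (a + of_nat m + 1 - of_nat j) (k - m - 1)"
        using pochhammer_product[of "m + 1 - j" "k - j" a] \<open>j \<le> m + 1\<close> \<open>j \<le> k\<close> k
        by (simp add: of_nat_diff algebra_simps)
      have a3: "pochhammer a (m + 1) =
          pochhammer a (m + 1 - j) * pochhammer (a + of_nat m + 1 - of_nat j) j"
        using pochhammer_product[of "m + 1 - j" "m + 1" a] \<open>j \<le> m + 1\<close>
        by (simp add: of_nat_diff algebra_simps)
      have c1: "pochhammer (- c - of_nat m - of_nat n + 1) j =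
          (-1) ^ j * pochhammer (c + of_nat (m + n) - of_nat j) j"
        using pochhammer_minus[of "c + of_nat (m + n) - 1" j] by (simp add: algebra_simps)
      have c2: "pochhammer c (m + n) =
          pochhammer c (m + n - j) * pochhammer (c + of_nat (m + n) - of_nat j) j"
        using pochhammer_product[of "m + n - j" "m + n" c] j
        by (simp add: of_nat_diff algebra_simps)
      have c3: "pochhammer c (m + n - j) =
          pochhammer c (k - j) * pochhammer (c + of_nat k - of_nat j) (m + n - k)"
        using pochhammer_product[of "k - j" "m + n - j" c] \<open>j \<le> k\<close> k j
        by (simp add: of_nat_diff algebra_simps)
      have b: "pochhammer (- of_nat n) j / fact j = (-1) ^ j * (of_nat (n choose j) :: 'a)"
        by (simp add: binomial_gbinomial gbinomial_pochhammer flip: power_mult_distrib mult.assoc)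
      have ne: "pochhammer (c + of_nat (m + n) - of_nat j) j \<noteq> 0"
        using c[of "m + n"] c2 by auto
      have "coeff ?Q j * ?f $ (k - j) =
          (pochhammer (- of_nat n) j / fact j) *
          (pochhammer (- a - of_nat m) j / pochhammer (- c - of_nat m - of_nat n + 1) j) *
          (pochhammer a (k - j) / pochhammer c (k - j))"
        using j by (simp add: coeff_hyp_pade_denom f_nth)
      also have "\<dots> = (-1) ^ j * of_nat (n choose j) *
          ((pochhammer (a + of_nat m + 1 - of_nat j) j * pochhammer a (k - j)) /
           (pochhammer (c + of_nat (m + n) - of_nat j) j * pochhammer c (k - j)))"
        unfolding b a1 c1 by simp
      also have "pochhammer (a + of_nat m + 1 - of_nat j) j * pochhammer a (k - j) =
          pochhammer a (m + 1) * poly p1 (of_nat j)"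
        unfolding a2 a3 p1(2) by simp
      also have "pochhammer a (m + 1) * poly p1 (of_nat j) /
          (pochhammer (c + of_nat (m + n) - of_nat j) j * pochhammer c (k - j)) =
          C * poly (p1 * p2) (of_nat j)"
      proof -
        have "pochhammer c (m + n) = pochhammer c (k - j) * poly p2 (of_nat j) *
           pochhammer (c + of_nat (m + n) - of_nat j) j"
          unfolding c2 c3 p2(2) ..
        then show ?thesis
          using c[of "m + n"] c[of "k - j"] ne by (simp add: C_def field_simps)
      qed
      finally show ?thesis by (simp add: mult_ac)
    qed
    have "degree (p1 * p2) < n"
      using degree_mult_le[of p1 p2] p1(1) p2(1) k by linarith
    have "(?f * fps_of_poly ?Q) $ k = (\<Sum>j=0..k. coeff ?Q j * ?f $ (k - j))"
      by (subst mult.commute) (simp add: fps_mult_nth)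
    also have "\<dots> = (\<Sum>j\<le>n. coeff ?Q j * ?f $ (k - j))"
      using mn k by (intro sum.mono_neutral_right) (auto simp: coeff_hyp_pade_denom)
    also have "\<dots> = C * (\<Sum>j\<le>n. (-1) ^ j * of_nat (n choose j) * poly (p1 * p2) (of_nat j))"
      by (simp add: summand sum_distrib_left del: poly_mult)
    also have "\<dots> = 0"
      using alternating_binomial_sum_poly_eq_0[OF \<open>degree (p1 * p2) < n\<close>] by simp
    finally show ?thesis .
  qed
  have coeffP: "coeff ?P k = (if k < Suc m then (?f * fps_of_poly ?Q) $ k else 0)" for k
    by (simp add: coeff_truncate_fps)
  have "degree ?P \<le> m"
    by (rule degree_le) (simp add: coeffP)
  moreover have "(?f * fps_of_poly ?Q - fps_of_poly ?P) $ k = 0" if "k \<le> m + n" for k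
  proof (cases "k \<le> m")
    case True
    then show ?thesis by (simp add: coeffP)
  next
    case False
    then show ?thesis using zero[of k] that by (simp add: coeffP)
  qed
  moreover have "?Q \<noteq> 0"
    using coeff_0_hyp_pade_denom[of a c m n] by auto
  ultimately show ?thesis
    by (simp add: is_pade_def degree_hyp_pade_denom)
qed

end

theory Submission
  imports Defs
begin

text \<open>
  For \<open>c > a > 0\<close> the coefficients of \<open>f\<close> are the moments of a Beta distribution on \<open>[0, 1]\<close>.
  Write \<open>g = P / Q\<close> as a power series, \<open>R(t) = t\<^sup>n Q(1/t)\<close> and \<open>S(t) = t\<^bsup>m+1-n\<^esup>\<close>, and let \<open>L\<close>
  and \<open>G\<close> be the linear functionals on polynomials sending \<open>t\<^sup>k\<close> to the \<open>k\<close>-th coefficient of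
  \<open>f\<close> and \<open>g\<close>. The approximation property says that \<open>L = G\<close> up to degree \<open>m + n\<close> and that
  \<open>G(S R p) = 0\<close> for all \<open>p\<close>. Reducing modulo \<open>R\<close>, positivity of \<open>L\<close> passes to \<open>G\<close> on \<open>S p\<^sup>2\<close>,
  \<open>S t p\<^sup>2\<close> and \<open>S (1 - t) p\<^sup>2\<close>, so the coefficients of \<open>g\<close> eventually decrease and all lie in
  \<open>[0, 1]\<close>. Since \<open>f\<close> and \<open>g\<close> agree up to order \<open>m + n\<close>, their difference is at most
  \<open>\<bar>z\<bar>\<^bsup>m+n+1\<^esup> / (1 - \<bar>z\<bar>)\<close>. Orthogonality of \<open>R\<close> with respect to \<open>L(S \<cdot>)\<close> puts its zeros into
  \<open>[0, 1]\<close>, so \<open>Q\<close> has no zeros in the open unit disc.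
\<close>

unbundle no vec_syntax

section \<open>Linear functionals given by moments\<close>

definition moment_functional :: "'a::comm_ring_1 fps \<Rightarrow> 'a poly \<Rightarrow> 'a" where
  "moment_functional f p = (\<Sum>i\<le>degree p. coeff p i * f $ i)"

lemma moment_functional_altdef:
  assumes "degree p \<le> N"
  shows "moment_functional f p = (\<Sum>i\<le>N. coeff p i * f $ i)"
  unfolding moment_functional_def
  using assms by (intro sum.mono_neutral_left) (auto simp: coeff_eq_0)

lemma moment_functional_0 [simp]: "moment_functional f 0 = 0"
  by (simp add: moment_functional_def)

lemma moment_functional_add: "moment_functional f (p + q) = moment_functional f p + moment_functional f q"
proof -
  let ?N = "max (degree p) (degree q)"
  have "degree (p + q) \<le> ?N" by (rule degree_add_le_max)
  then show ?thesis
    by (simp add: moment_functional_altdef[of _ ?N] distrib_right sum.distrib)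
qed

lemma moment_functional_smult: "moment_functional f (smult c p) = c * moment_functional f p"
  using degree_smult_le[of c p]
  by (simp add: moment_functional_altdef[of _ "degree p"] sum_distrib_left mult.assoc)

lemma moment_functional_minus: "moment_functional f (- p) = - moment_functional f p"
  using moment_functional_smult[of f "-1" p] by simp

lemma moment_functional_diff: "moment_functional f (p - q) = moment_functional f p - moment_functional f q"
  using moment_functional_add[of f p "-q"] by (simp add: moment_functional_minus)

lemma moment_functional_sum: "moment_functional f (sum p A) = (\<Sum>i\<in>A. moment_functional f (p i))"
  by (induction A rule: infinite_finite_induct) (auto simp: moment_functional_add)

lemma moment_functional_monom: "moment_functional f (monom c k) = c * f $ k"
proof -
  have "moment_functional f (monom c k) = (\<Sum>i\<le>k. coeff (monom c k) i * f $ i)"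
    by (intro moment_functional_altdef degree_monom_le)
  also have "\<dots> = (\<Sum>i\<le>k. if i = k then c * f $ i else 0)"
    by (intro sum.cong) auto
  finally show ?thesis by simp
qed

lemma moment_functional_cong:
  assumes "degree p \<le> N" "\<And>k. k \<le> N \<Longrightarrow> f $ k = g $ k"
  shows "moment_functional f p = moment_functional g p"
  using assms by (simp add: moment_functional_altdef[of p N])

text \<open>Linearity reduces orthogonality of \<open>R\<close> to a test on monomials.\<close>

lemma moment_functional_mult_eq_0:
  assumes "\<And>i. i \<le> N \<Longrightarrow> moment_functional f (monom 1 i * R) = 0" "degree p \<le> N"
  shows "moment_functional f (p * R) = 0"
proof -
  have "p * R = (\<Sum>i\<le>degree p. monom (coeff p i) i) * R"
    by (simp add: poly_as_sum_of_monoms)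
  also have "\<dots> = (\<Sum>i\<le>degree p. smult (coeff p i) (monom 1 i * R))"
    by (simp add: sum_distrib_right smult_monom flip: mult_smult_left)
  finally show ?thesis
    using assms by (simp add: moment_functional_sum moment_functional_smult)
qed

section \<open>Positive functionals on [0, 1] and the Beta integral\<close>

definition moment_positive :: "real fps \<Rightarrow> bool" where
  "moment_positive f \<longleftrightarrow>
     (\<forall>p. p \<noteq> 0 \<longrightarrow> (\<forall>t\<in>{0..1}. 0 \<le> poly p t) \<longrightarrow> 0 < moment_functional f p)"

lemma moment_positiveD:
  assumes "moment_positive f" "p \<noteq> 0" "\<And>t. 0 \<le> t \<Longrightarrow> t \<le> 1 \<Longrightarrow> 0 \<le> poly p t"
  shows "0 < moment_functional f p"
  using assms by (auto simp: moment_positive_def)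

lemma moment_positiveD':
  assumes "moment_positive f" "\<And>t. 0 \<le> t \<Longrightarrow> t \<le> 1 \<Longrightarrow> 0 \<le> poly p t"
  shows "0 \<le> moment_functional f p"
proof (cases "p = 0")
  case False
  then show ?thesis using moment_positiveD[OF assms(1) _ assms(2)] by (simp add: less_imp_le)
qed simp

lemma moment_positive_coeff:
  assumes "moment_positive f"
  shows "0 \<le> f $ k" "f $ k \<le> f $ 0"
proof -
  have "0 \<le> moment_functional f (monom 1 k)"
    using assms by (intro moment_positiveD') (auto simp: poly_monom)
  then show "0 \<le> f $ k" by (simp add: moment_functional_monom)
  have "0 \<le> moment_functional f (monom 1 0 - monom 1 k)"
    using assms by (intro moment_positiveD') (auto simp: poly_monom power_le_one)
  then show "f $ k \<le> f $ 0" by (simp only: moment_functional_monom moment_functional_diff)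
qed

text \<open>Since Beta(a + k, c - a) / Beta(a, c - a) = (a)_k / (c)_k, the functional is integration
  against the normalized Beta density. If the integral of a nonnegative polynomial vanished, the
  polynomial would be zero on a whole interval, hence identically.\<close>

lemma moment_positive_hyp_2F1:
  fixes a c :: real
  assumes ac: "0 < a" "a < c"
  shows "moment_positive (hyp_2F1_fps a 1 c)"
proof -
  define f where "f = hyp_2F1_fps a 1 c"
  define w where "w t = t powr (a - 1) * (1 - t) powr (c - a - 1)" for t :: real
  define B where "B = Beta a (c - a)"
  have Gpos: "Gamma a > 0" "Gamma (c - a) > 0" "Gamma c > 0" "pochhammer c k > 0" for k
    using ac by (auto intro!: Gamma_real_pos pochhammer_pos)
  have "B > 0" using Gpos by (simp add: B_def Beta_def)
  have mom: "((\<lambda>t. t ^ k * w t) has_integral (B * f $ k)) {0..1}" for k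
  proof -
    have "Beta (a + real k) (c - a) = B * f $ k"
    proof -
      have "a \<notin> \<int>\<^sub>\<le>\<^sub>0" "c \<notin> \<int>\<^sub>\<le>\<^sub>0" using ac by (auto elim!: nonpos_Ints_cases)
      then have "Gamma (a + real k) = Gamma a * pochhammer a k"
        "Gamma (c + real k) = Gamma c * pochhammer c k"
        using Gpos by (simp_all add: pochhammer_Gamma)
      then show ?thesis
        using Gpos(4)[of k]
        by (simp add: Beta_def B_def f_def hyp_2F1_fps_nth add.commute field_simps flip: pochhammer_fact)
    qed
    moreover have "((\<lambda>t. t powr (a + real k - 1) * (1 - t) powr (c - a - 1)) has_integral
        Beta (a + real k) (c - a)) {0..1}"
      using ac by (intro has_integral_Beta_real) auto
    moreover have "t powr (a + real k - 1) * (1 - t) powr (c - a - 1) = t ^ k * w t"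
      if "t \<in> {0..1}" for t
    \<comment> \<open>At t = 0 the law for adding exponents under \<open>powr\<close> fails, but
      \<open>0 powr x\<close> is 0 for every \<open>x\<close>, so both sides vanish.\<close>
    proof (cases "t = 0")
      case False
      then have "t powr (a + real k - 1) = t powr (a - 1) * t powr real k"
        by (simp flip: powr_add add: algebra_simps)
      then show ?thesis using False that by (simp add: w_def powr_realpow)
    qed (simp add: w_def)
    ultimately show ?thesis by (metis (no_types, lifting) has_integral_cong)
  qed
  have int: "((\<lambda>t. poly p t * w t) has_integral (B * moment_functional f p)) {0..1}" for p
  proof -
    have "((\<lambda>t. \<Sum>i\<le>degree p. coeff p i * (t ^ i * w t)) has_integral
        (\<Sum>i\<le>degree p. coeff p i * (B * f $ i))) {0..1}"
      by (intro has_integral_sum has_integral_mult_right mom) auto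
    then show ?thesis
      by (simp add: poly_altdef moment_functional_def sum_distrib_left sum_distrib_right mult_ac)
  qed
  have "0 < moment_functional f p"
    if p: "p \<noteq> 0" "\<And>t. t \<in> {0..1} \<Longrightarrow> 0 \<le> poly p t" for p
  proof -
    let ?h = "\<lambda>t. poly p t * w t"
    have nonneg: "0 \<le> ?h t" if "t \<in> {0..1}" for t
      using p(2)[OF that] by (auto simp: w_def intro!: mult_nonneg_nonneg)
    have ge: "0 \<le> B * moment_functional f p"
      by (rule has_integral_nonneg[OF int nonneg])
    have "B * moment_functional f p \<noteq> 0"
    proof
      assume "B * moment_functional f p = 0"
      then have 0: "integral {0..1} ?h = 0" using int[of p] by (simp add: integral_unique)
      \<comment> \<open>Any closed interval inside (0, 1) would do: it avoids the possible
        singularities of \<open>w\<close> at the endpoints, and \<open>w\<close> has no zero on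
        it.\<close>
      have cont: "continuous_on {1/4..3/4} ?h"
        unfolding w_def by (intro continuous_intros) auto
      then have intg: "?h integrable_on {1/4..3/4}" by (rule integrable_continuous_real)
      have "integral {1/4..3/4} ?h \<le> integral {0..1} ?h"
        using int[of p] nonneg intg by (intro integral_subset_le) (auto simp: integrable_on_def)
      moreover have "integral {1/4..3/4} ?h \<ge> 0"
        by (rule integral_nonneg[OF intg]) (auto intro: nonneg)
      ultimately have "(?h has_integral 0) (cbox (1/4) (3/4))"
        using 0 intg by (simp add: has_integral_integral)
      then have h0: "?h t = 0" if "t \<in> {1/4..3/4}" for t
        using that cont by (intro has_integral_0_cbox_imp_0[of "1/4" "3/4" ?h t])
          (auto intro: nonneg)
      have w0: "w t \<noteq> 0" if "t \<in> {1/4..3/4}" for t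
        using that by (auto simp: w_def)
      have "{1/4..3/4} \<subseteq> {t. poly p t = 0}"
      proof (intro subsetI CollectI)
        fix t :: real assume "t \<in> {1/4..3/4}"
        from h0[OF this] w0[OF this] show "poly p t = 0" by simp
      qed
      then have "finite {1/4..3/4::real}"
        using poly_roots_finite[OF p(1)] finite_subset by blast
      then show False by (simp add: infinite_Icc)
    qed
    with ge have "0 < B * moment_functional f p" by linarith
    then show ?thesis using \<open>B > 0\<close> by (simp add: zero_less_mult_iff)
  qed
  then show ?thesis by (auto simp: moment_positive_def f_def)
qed

section \<open>Embedding real power series into other algebras\<close>

definition of_real_fps :: "real fps \<Rightarrow> 'a::{real_algebra_1,comm_ring_1} fps" where
  "of_real_fps f = Abs_fps (\<lambda>k. of_real (f $ k))"

lemma of_real_fps_nth [simp]: "of_real_fps f $ k = of_real (f $ k)"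
  by (simp add: of_real_fps_def)

lemma of_real_fps_mult: "of_real_fps (f * g) = of_real_fps f * of_real_fps g"
  by (rule fps_ext) (simp add: fps_mult_nth)

lemma of_real_fps_of_poly: "of_real_fps (fps_of_poly p) = fps_of_poly (map_poly of_real p)"
  by (rule fps_ext) (simp add: coeff_map_poly)

lemma fps_conv_radius_of_real_fps:
  assumes "\<And>k. \<bar>f $ k\<bar> \<le> B"
  shows "fps_conv_radius (of_real_fps f :: complex fps) \<ge> 1"
  unfolding fps_conv_radius_def
proof (rule conv_radius_geI_ex')
  fix r :: real assume r: "0 < r" "ereal r < 1"
  have "summable (\<lambda>k. B * r ^ k)" using r by (intro summable_mult summable_geometric) auto
  moreover have "norm (of_real_fps f $ k * of_real r ^ k :: complex) \<le> B * r ^ k" for k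
    using assms[of k] r by (simp add: norm_mult norm_power mult_right_mono)
  ultimately show "summable (\<lambda>k. of_real_fps f $ k * of_real r ^ k :: complex)"
    by (rule summable_comparison_test'[where N = 0])
qed

section \<open>Pade approximants of a positive moment series\<close>

locale moment_pade =
  fixes f :: "real fps" and m n :: nat and P Q :: "real poly"
  assumes pos: "moment_positive f"
    and pade: "is_pade f m n P Q"
    and Q0: "coeff Q 0 = 1"
    and mn: "n \<le> m + 1"
begin

definition g :: "real fps" where "g = fps_of_poly P * inverse (fps_of_poly Q)"

definition R :: "real poly" where "R = (\<Sum>j\<le>n. monom (coeff Q j) (n - j))"

definition S :: "real poly" where "S = monom 1 (m + 1 - n)"

lemma degP: "degree P \<le> m" and degQ: "degree Q \<le> n"
  using pade by (auto simp: is_pade_def)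

lemma g_mult_Q: "g * fps_of_poly Q = fps_of_poly P"
proof -
  have "inverse (fps_of_poly Q) * fps_of_poly Q = 1"
    by (rule inverse_mult_eq_1) (simp add: Q0)
  then show ?thesis by (simp add: g_def mult.assoc)
qed

text \<open>\<open>f * Q - P\<close> equals \<open>(f - g) * Q\<close>, and \<open>Q\<close> is an
  invertible series, so the order of vanishing passes to \<open>f - g\<close>.\<close>

lemma f_eq_g:
  assumes "k \<le> m + n"
  shows "f $ k = g $ k"
proof -
  have "f * fps_of_poly Q - fps_of_poly P = (f - g) * fps_of_poly Q"
    by (simp add: algebra_simps flip: g_mult_Q)
  then have 0: "((f - g) * fps_of_poly Q) $ k = 0" if "k \<le> m + n" for k
    using pade that by (auto simp: is_pade_def)
  have "(f - g) $ k = ((f - g) * fps_of_poly Q * inverse (fps_of_poly Q)) $ k"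
    using inverse_mult_eq_1'[of "fps_of_poly Q"] Q0 by (simp add: mult.assoc)
  also have "\<dots> = (\<Sum>i=0..k. ((f - g) * fps_of_poly Q) $ i * inverse (fps_of_poly Q) $ (k - i))"
    by (rule fps_mult_nth)
  also have "\<dots> = 0" using 0 assms by (intro sum.neutral) auto
  finally show ?thesis by simp
qed

text \<open>The constant term 1 of \<open>Q\<close> becomes the leading coefficient of
  \<open>R\<close>, so the degree is exactly \<open>n\<close> even if that of \<open>Q\<close> is
  smaller.\<close>

lemma degR: "degree R = n" and R_nz: "R \<noteq> 0"
proof -
  have "coeff R n = (\<Sum>j\<le>n. if j = 0 then coeff Q j else 0)"
    unfolding R_def coeff_sum by (intro sum.cong) auto
  then have 1: "coeff R n = 1" by (simp add: Q0)
  have "degree R \<le> n"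
    unfolding R_def by (intro degree_sum_le) (auto intro: order.trans[OF degree_monom_le])
  with 1 show "degree R = n" by (metis le_antisym le_degree zero_neq_one)
  from 1 show "R \<noteq> 0" by auto
qed

text \<open>Applied to t^i S R, the functional of \<open>g\<close> yields the coefficient of
  \<open>g * Q = P\<close> at \<open>m + 1 + i\<close>, which lies beyond the degree of
  \<open>P\<close>.\<close>

lemma moment_g_R: "moment_functional g (S * (R * p)) = 0"
proof -
  have "moment_functional g (monom 1 i * (S * R)) = 0" for i
  proof -
    have "monom 1 i * (S * R) = (\<Sum>j\<le>n. monom (coeff Q j) (m + 1 + i - j))"
      unfolding S_def R_def sum_distrib_left mult_monom
      using mn by (intro sum.cong) (auto intro!: arg_cong[of _ _ "monom _"])
    then have "moment_functional g (monom 1 i * (S * R)) = (\<Sum>j\<le>n. coeff Q j * g $ (m + 1 + i - j))"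
      by (simp add: moment_functional_sum moment_functional_monom)
    also have "\<dots> = (\<Sum>j=0..m + 1 + i. coeff Q j * g $ (m + 1 + i - j))"
      using mn degQ by (intro sum.mono_neutral_left) (auto simp: coeff_eq_0)
    also have "\<dots> = (g * fps_of_poly Q) $ (m + 1 + i)"
      by (subst mult.commute) (simp add: fps_mult_nth)
    also have "\<dots> = 0"
      using degP by (simp add: g_mult_Q coeff_eq_0)
    finally show ?thesis .
  qed
  then have "moment_functional g (p * (S * R)) = 0"
    by (rule moment_functional_mult_eq_0) auto
  then show ?thesis by (simp add: mult_ac)
qed

lemma degS: "degree S = m + 1 - n"
  by (simp add: S_def degree_monom_eq)

text \<open>The degree count is (m + 1 - n) + (2n - 1) = m + n, exactly the order of agreement of
  \<open>f\<close> and \<open>g\<close>.\<close>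

lemma moment_f_eq_g:
  assumes "degree p < 2 * n"
  shows "moment_functional f (S * p) = moment_functional g (S * p)"
proof (rule moment_functional_cong[of _ "m + n"])
  have "degree (S * p) \<le> m + 1 - n + degree p"
    using degree_mult_le[of S p] by (simp add: degS)
  then show "degree (S * p) \<le> m + n" using assms mn by linarith
qed (rule f_eq_g)

lemma moment_f_R:
  assumes "degree p < n"
  shows "moment_functional f (S * (R * p)) = 0"
proof -
  have "degree (R * p) < 2 * n" using degree_mult_le[of R p] assms degR by linarith
  then show ?thesis by (simp add: moment_f_eq_g moment_g_R)
qed

section \<open>Bounds for the coefficients of the approximant\<close>

text \<open>
  Modulo \<^term>\<open>R\<close> the square \<open>p\<^sup>2\<close> may be replaced by the square of a polynomial of degree
  less than \<^term>\<open>n\<close>, and on the resulting degrees the moments of \<^term>\<open>f\<close> and \<^term>\<open>g\<close> agree.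
\<close>

lemma moment_g_nonneg:
  assumes h: "degree h \<le> 1" "\<And>t. 0 \<le> t \<Longrightarrow> t \<le> 1 \<Longrightarrow> 0 \<le> poly h t"
  shows "0 \<le> moment_functional g (S * (h * p\<^sup>2))"
proof -
  define r d where "r = p mod R" and "d = p div R"
  have p: "p = d * R + r" by (simp only: r_def d_def div_mult_mod_eq)
  have "S * (h * p\<^sup>2) = S * (R * (h * (d * d * R + 2 * d * r))) + S * (h * r\<^sup>2)"
    unfolding p by (simp add: algebra_simps power2_eq_square)
  then have eq: "moment_functional g (S * (h * p\<^sup>2)) = moment_functional g (S * (h * r\<^sup>2))"
    by (simp only: moment_functional_add moment_g_R)
  show ?thesis
  \<comment> \<open>The zero remainder is separate because its degree 0 is not below
    \<open>n\<close> when \<open>n = 0\<close>.\<close>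
  proof (cases "r = 0")
    case True
    then show ?thesis by (simp add: eq)
  next
    case False
    then have "degree r < n"
      using degree_mod_less'[of R p] R_nz degR by (simp add: r_def)
    moreover have "degree (h * r\<^sup>2) \<le> degree h + 2 * degree r"
      using degree_mult_le[of h "r\<^sup>2"] degree_power_le[of r 2] by linarith
    ultimately have "degree (h * r\<^sup>2) < 2 * n" using h(1) by linarith
    then have "moment_functional g (S * (h * r\<^sup>2)) = moment_functional f (S * (h * r\<^sup>2))"
      by (simp add: moment_f_eq_g)
    also have "\<dots> \<ge> 0"
      by (rule moment_positiveD'[OF pos]) (auto simp: S_def poly_monom h(2))
    finally show ?thesis by (simp add: eq)
  qed
qed

lemma g_shift: "moment_functional g (S * monom 1 k) = g $ (m + 1 - n + k)"
  by (simp add: S_def mult_monom moment_functional_monom)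

text \<open>t^k is a square times 1 or t, depending on the parity of k, and both are admissible
  factors \<open>h\<close>.\<close>

lemma g_nonneg: "0 \<le> g $ (m + 1 - n + k)"
proof -
  have "0 \<le> moment_functional g (S * (monom 1 (k mod 2) * (monom 1 (k div 2))\<^sup>2))"
    by (rule moment_g_nonneg) (auto simp: degree_monom_eq poly_monom)
  also have "monom 1 (k mod 2) * (monom 1 (k div 2))\<^sup>2 = (monom 1 k :: real poly)"
    by (simp add: power2_eq_square mult_monom flip: mult_2)
  finally show ?thesis by (simp only: g_shift)
qed

text \<open>Odd exponents use \<open>t (1 - t) = t (1 - t)\<^sup>2 + (1 - t) t\<^sup>2\<close>.\<close>

lemma g_decreasing: "g $ (m + 1 - n + Suc k) \<le> g $ (m + 1 - n + k)"
proof -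
  define x :: "real poly" where "x = monom 1 1"
  have mon: "monom 1 i = x ^ i" for i by (simp add: x_def monom_power)
  have degx: "degree x \<le> 1" "degree (1 - x) \<le> 1"
    using degree_diff_le[of 1 1 x] by (simp_all add: x_def degree_monom_eq)
  have polyx: "poly x t = t" for t by (simp add: x_def poly_monom)
  have "0 \<le> moment_functional g (S * ((1 - x) * x ^ k))"
  proof (cases "even k")
    case True
    then obtain i where k: "k = 2 * i" by auto
    have "(1 - x) * x ^ k = (1 - x) * (x ^ i)\<^sup>2"
      by (simp only: k power_mult mult.commute[of 2])
    also have "0 \<le> moment_functional g (S * \<dots>)"
      using degx by (intro moment_g_nonneg) (auto simp: polyx)
    finally show ?thesis .
  next
    case False
    then obtain i where k: "k = 2 * i + 1" by (auto elim: oddE)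
    have "(1 - x) * x ^ k = x * ((1 - x) * x ^ i)\<^sup>2 + (1 - x) * (x ^ (i + 1))\<^sup>2"
      by (simp add: k power_mult power2_eq_square algebra_simps power_add flip: mult_2)
    then have "S * ((1 - x) * x ^ k) =
        S * (x * ((1 - x) * x ^ i)\<^sup>2) + S * ((1 - x) * (x ^ (i + 1))\<^sup>2)"
      by (simp only: distrib_left)
    moreover have "0 \<le> moment_functional g (S * (x * ((1 - x) * x ^ i)\<^sup>2))"
      using degx by (intro moment_g_nonneg) (auto simp: polyx)
    moreover have "0 \<le> moment_functional g (S * ((1 - x) * (x ^ (i + 1))\<^sup>2))"
      using degx by (intro moment_g_nonneg) (auto simp: polyx)
    ultimately show ?thesis by (simp only: moment_functional_add)
  qed
  also have "S * ((1 - x) * x ^ k) = S * monom 1 k - S * monom 1 (Suc k)"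
    by (simp add: mon algebra_simps)
  finally show ?thesis by (simp only: moment_functional_diff g_shift)
qed

text \<open>Up to index \<open>m + n\<close> the coefficients are those of \<open>f\<close>; from
  \<open>m + 1 - n\<close> on they are nonnegative and decreasing. These two ranges cover all
  indices.\<close>

lemma g_bounds: "0 \<le> g $ k" "g $ k \<le> f $ 0"
proof -
  have f: "0 \<le> f $ i" "f $ i \<le> f $ 0" for i
    using moment_positive_coeff[OF pos] by auto
  have "g $ (m + 1 - n) \<le> f $ 0"
  \<comment> \<open>The starting index \<open>m + 1 - n\<close> is at most \<open>m + n\<close>
    except for \<open>n = 0\<close>, where \<open>g\<close> is the polynomial \<open>P\<close> and
    its coefficient at \<open>m + 1\<close> is 0.\<close>
  proof (cases "n = 0")
    case False
    then show ?thesis using f(2)[of "m + 1 - n"] f_eq_g[of "m + 1 - n"] by simp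
  next
    case True
    then have "degree Q = 0" using degQ by simp
    then obtain b where "Q = [:b:]" by (rule degree_eq_zeroE)
    then have "Q = 1" using Q0 by simp
    then have "g = fps_of_poly P" using g_mult_Q by simp
    then show ?thesis using True degP f(1)[of 0] by (simp add: coeff_eq_0)
  qed
  then have *: "g $ (m + 1 - n + i) \<le> f $ 0" for i
    using g_decreasing by (induction i) (auto intro: order.trans)
  have "0 \<le> g $ k \<and> g $ k \<le> f $ 0"
  proof (cases "k \<le> m + n")
    case True
    then show ?thesis using f[of k] f_eq_g by simp
  next
    case False
    then have "k = m + 1 - n + (k - (m + 1 - n))" using mn by linarith
    then show ?thesis using * g_nonneg by metis
  qed
  then show "0 \<le> g $ k" "g $ k \<le> f $ 0" by auto
qed

lemma f_minus_g_bound: "\<bar>f $ k - g $ k\<bar> \<le> f $ 0"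
  using moment_positive_coeff[OF pos, of k] g_bounds[of k] by linarith

section \<open>Location of the zeros of R and Q\<close>

text \<open>
  The orthogonality argument for the zeros of orthogonal polynomials, with the cofactor of
  \<open>t - \<zeta>\<close> in \<^term>\<open>R\<close> split into real and imaginary part \<open>u + \<i>v\<close>.
\<close>

lemma norm_root_R_le_1:
  fixes \<zeta> :: complex
  assumes root: "poly (map_poly of_real R) \<zeta> = 0"
  shows "norm \<zeta> \<le> 1"
proof -
  define RC :: "complex poly" where "RC = map_poly of_real R"
  have RC_nz: "RC \<noteq> 0" using R_nz by (simp add: RC_def map_poly_eq_0_iff)
  from root obtain s where s: "RC = [:-\<zeta>, 1:] * s"
    by (auto simp: RC_def poly_eq_0_iff_dvd elim: dvdE)
  with RC_nz have s_nz: "s \<noteq> 0" by auto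
  have "degree RC = n" by (simp add: RC_def degR degree_map_poly)
  then have degs: "Suc (degree s) = n" using degree_mult_eq[of "[:-\<zeta>, 1:]" s] s s_nz by simp
  define x y where "x = Re \<zeta>" and "y = Im \<zeta>"
  define u v where "u = map_poly Re s" and "v = map_poly Im s"
  have deg: "degree u < n" "degree v < n"
    using degs map_poly_degree_leq[of Re s] map_poly_degree_leq[of Im s] by (auto simp: u_def v_def)
  have uv_nz: "u \<noteq> 0 \<or> v \<noteq> 0"
  proof (rule ccontr)
    assume "\<not> ?thesis"
    then have "coeff u i = 0 \<and> coeff v i = 0" for i by simp
    then have "coeff s i = 0" for i by (simp add: u_def v_def coeff_map_poly complex_eq_iff)
    with s_nz show False by (simp add: poly_eq_iff)
  qed
  have cR: "of_real (coeff R i) = (case i of 0 \<Rightarrow> 0 | Suc j \<Rightarrow> coeff s j) - \<zeta> * coeff s i" for i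
  proof -
    have "of_real (coeff R i) = coeff RC i" by (simp add: RC_def coeff_map_poly)
    then show ?thesis by (simp add: s coeff_pCons split: nat.splits)
  qed
  \<comment> \<open>\<open>R1\<close> and \<open>R2\<close> are the real and imaginary parts of R =
    (t - x - iy)(u + iv); the imaginary part of \<open>R\<close> is zero.\<close>
  have R1: "R = [:-x, 1:] * u + smult y v" (is "?lhs = ?rhs")
  proof (rule poly_eqI)
    fix i
    show "coeff ?lhs i = coeff ?rhs i"
      using cR[of i] by (cases i) (simp_all add: u_def v_def coeff_map_poly x_def y_def complex_eq_iff)
  qed
  have R2: "[:-x, 1:] * v = smult y u" (is "?lhs = ?rhs")
  proof (rule poly_eqI)
    fix i
    show "coeff ?lhs i = coeff ?rhs i"
      using cR[of i] by (cases i) (simp_all add: u_def v_def coeff_map_poly x_def y_def complex_eq_iff)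
  qed
  define L where "L p = moment_functional f (S * p)" for p
  have L_add: "L (p + q) = L p + L q" and L_smult: "L (smult b p) = b * L p" for p q b
    by (simp_all add: L_def distrib_left moment_functional_add moment_functional_smult)
  have L_nonneg: "0 \<le> L p" if "\<And>t. 0 \<le> t \<Longrightarrow> t \<le> 1 \<Longrightarrow> 0 \<le> poly p t" for p
    unfolding L_def using that by (intro moment_positiveD'[OF pos]) (auto simp: S_def poly_monom)
  \<comment> \<open>Strictness in \<open>moment_positive\<close> matters here: this value is
    cancelled below.\<close>
  have L_pos: "0 < L (u\<^sup>2 + v\<^sup>2)"
    unfolding L_def
  proof (rule moment_positiveD[OF pos])
    have "poly (u\<^sup>2 + v\<^sup>2) \<noteq> poly 0"
    proof
      assume "poly (u\<^sup>2 + v\<^sup>2) = poly 0"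
      then have "(poly u t)\<^sup>2 + (poly v t)\<^sup>2 = 0" for t
        by (metis poly_0 poly_add poly_power)
      then have "poly u t = 0 \<and> poly v t = 0" for t
        by (simp add: sum_power2_eq_zero_iff)
      then show False using uv_nz by (metis poly_all_0_iff_0)
    qed
    then show "S * (u\<^sup>2 + v\<^sup>2) \<noteq> 0" by (auto simp: S_def)
  qed (auto simp: S_def poly_monom)
  have Ru: "L (R * u) = 0" and Rv: "L (R * v) = 0"
    using deg by (simp_all add: L_def moment_f_R)
  \<comment> \<open>By \<open>R2\<close> the product \<open>R * v\<close> is y (u^2 + v^2), so
    orthogonality to \<open>v\<close> makes the zero real.\<close>
  have "R * v = [:-x, 1:] * v * u + smult y (v\<^sup>2)"
    by (simp only: R1 distrib_left distrib_right mult_smult_left mult_smult_right power2_eq_square mult_ac)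
  also have "\<dots> = smult y (u\<^sup>2 + v\<^sup>2)"
    by (simp only: R2 mult_smult_left power2_eq_square smult_add_right)
  finally have "y * L (u\<^sup>2 + v\<^sup>2) = 0" using Rv by (simp add: L_smult)
  with L_pos have y: "y = 0" by simp
  \<comment> \<open>Now orthogonality to \<open>u\<close> exhibits x as the mean of t for the weight
    u^2 + v^2 under \<open>L\<close>. Positivity on t and 1 - t places this mean in [0, 1].\<close>
  have "R * u = [:-x, 1:] * u\<^sup>2"
    by (simp only: R1 y smult_0_left add_0_right power2_eq_square mult_ac)
  moreover have "[:-x, 1:] * v * v = 0"
    by (simp only: R2 y smult_0_left mult_zero_left)
  then have "[:-x, 1:] * v\<^sup>2 = 0" by (simp only: power2_eq_square mult.assoc)
  ultimately have "R * u = [:-x, 1:] * (u\<^sup>2 + v\<^sup>2)" by (simp only: distrib_left add_0_right)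
  also have "\<dots> = [:0, 1:] * (u\<^sup>2 + v\<^sup>2) + smult (- x) (u\<^sup>2 + v\<^sup>2)" by simp
  finally have x1: "L ([:0, 1:] * (u\<^sup>2 + v\<^sup>2)) = x * L (u\<^sup>2 + v\<^sup>2)"
    using Ru by (simp only: L_add L_smult)
  have "0 \<le> L ([:0, 1:] * (u\<^sup>2 + v\<^sup>2))" by (rule L_nonneg) auto
  then have "0 \<le> x" using x1 L_pos by (simp add: zero_le_mult_iff)
  have "[:1, -1:] * (u\<^sup>2 + v\<^sup>2) + [:0, 1:] * (u\<^sup>2 + v\<^sup>2) = u\<^sup>2 + v\<^sup>2" by simp
  then have "L ([:1, -1:] * (u\<^sup>2 + v\<^sup>2)) + x * L (u\<^sup>2 + v\<^sup>2) = L (u\<^sup>2 + v\<^sup>2)"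
    by (metis L_add x1)
  moreover have "0 \<le> L ([:1, -1:] * (u\<^sup>2 + v\<^sup>2))"
    by (rule L_nonneg, unfold poly_mult, intro mult_nonneg_nonneg) auto
  ultimately have "x * L (u\<^sup>2 + v\<^sup>2) \<le> 1 * L (u\<^sup>2 + v\<^sup>2)" by linarith
  then have "x \<le> 1" using L_pos by (simp only: mult_le_cancel_right_pos)
  have "\<zeta> = of_real x" by (simp add: complex_eq_iff x_def y[unfolded y_def])
  then show ?thesis using \<open>0 \<le> x\<close> \<open>x \<le> 1\<close> by simp
qed

text \<open>A zero z of \<open>Q\<close> in the disc is not 0, because \<open>Q\<close> has constant
  term 1. Then 1/z is a zero of \<open>R\<close> of modulus greater than 1.\<close>

lemma Q_nonzero:
  fixes z :: complex
  assumes "norm z < 1"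
  shows "poly (map_poly of_real Q) z \<noteq> 0"
proof
  assume 0: "poly (map_poly of_real Q) z = 0"
  have "z \<noteq> 0" using 0 Q0 by (auto simp: poly_0_coeff_0 coeff_map_poly)
  have cQ: "poly (map_poly of_real Q) z = (\<Sum>j\<le>n. of_real (coeff Q j) * z ^ j)"
    unfolding poly_altdef using degQ
    by (intro sum.mono_neutral_cong_left) (auto simp: degree_map_poly coeff_map_poly coeff_eq_0)
  have "map_poly of_real R = (\<Sum>j\<le>n. monom (of_real (coeff Q j)) (n - j) :: complex poly)"
    by (intro poly_eqI) (simp add: R_def coeff_map_poly coeff_sum if_distrib cong: if_cong)
  then have "poly (map_poly of_real R) (inverse z) = (\<Sum>j\<le>n. of_real (coeff Q j) * inverse z ^ (n - j))"
    by (simp add: poly_sum poly_monom)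
  also have "\<dots> = inverse z ^ n * (\<Sum>j\<le>n. of_real (coeff Q j) * z ^ j)"
    using \<open>z \<noteq> 0\<close> by (simp add: sum_distrib_left power_diff field_simps)
  finally have "poly (map_poly of_real R) (inverse z) = 0" using 0 cQ by simp
  then have "norm (inverse z) \<le> 1" by (rule norm_root_R_le_1)
  then show False using assms \<open>z \<noteq> 0\<close> one_less_inverse[of "norm z"] by (simp add: norm_inverse)
qed

section \<open>Uniqueness of the numerator and the error estimate\<close>

lemma P_unique:
  assumes "is_pade (of_real_fps f) m n P' (map_poly of_real Q :: 'b::real_normed_field poly)"
  shows "P' = map_poly of_real P"
proof (rule poly_eqI)
  fix k
  show "coeff P' k = coeff (map_poly of_real P) k"
  proof (cases "k \<le> m")
    case True
    have "coeff P' k = (of_real_fps f * fps_of_poly (map_poly of_real Q)) $ k"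
      using assms True by (simp add: is_pade_def)
    also have "\<dots> = of_real ((f * fps_of_poly Q) $ k)"
      by (simp flip: of_real_fps_of_poly of_real_fps_mult)
    also have "(f * fps_of_poly Q) $ k = coeff P k"
      using pade True by (simp add: is_pade_def)
    finally show ?thesis by (simp add: coeff_map_poly)
  next
    case False
    then show ?thesis using assms degP by (simp add: is_pade_def coeff_map_poly coeff_eq_0)
  qed
qed

text \<open>Bounded coefficients make the series \<open>g\<close> converge in the disc, where it
  equals P/Q because \<open>Q\<close> has no zero there. The first \<open>m + n + 1\<close> terms of
  \<open>g - f\<close> cancel, and a geometric series dominates the rest.\<close>

lemma pade_error:
  fixes z :: complex
  assumes z: "norm z < 1"
  shows "norm (poly (map_poly of_real P) z / poly (map_poly of_real Q) z - eval_fps (of_real_fps f) z)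
           \<le> f $ 0 * norm z ^ (m + n + 1) / (1 - norm z)"
proof -
  let ?M = "m + n + 1"
  have bf: "\<bar>f $ k\<bar> \<le> f $ 0" and bg: "\<bar>g $ k\<bar> \<le> f $ 0" for k
    using moment_positive_coeff[OF pos, of k] g_bounds[of k] by auto
  have rad: "norm z < fps_conv_radius (of_real_fps f :: complex fps)"
    "norm z < fps_conv_radius (of_real_fps g :: complex fps)"
    using z fps_conv_radius_of_real_fps[of f "f $ 0", OF bf]
      fps_conv_radius_of_real_fps[of g "f $ 0", OF bg]
    by (auto intro: less_le_trans[of _ 1])
  have "eval_fps (of_real_fps g) z * poly (map_poly of_real Q) z = poly (map_poly of_real P) z"
    using rad(2) eval_fps_mult[of z "of_real_fps g" "fps_of_poly (map_poly of_real Q)"]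
    by (simp flip: of_real_fps_of_poly of_real_fps_mult add: g_mult_Q)
      (simp add: of_real_fps_of_poly)
  then have quot: "poly (map_poly of_real P) z / poly (map_poly of_real Q) z = eval_fps (of_real_fps g) z"
    using Q_nonzero[OF z] by (simp add: field_simps)
  let ?d = "\<lambda>k. of_real (g $ k - f $ k) * z ^ k"
  have "?d sums (eval_fps (of_real_fps g) z - eval_fps (of_real_fps f) z)"
    using sums_diff[OF sums_eval_fps[OF rad(2)] sums_eval_fps[OF rad(1)]]
    by (simp add: algebra_simps)
  then have "(\<lambda>k. ?d (k + ?M)) sums (eval_fps (of_real_fps g) z - eval_fps (of_real_fps f) z)"
    by (subst sums_zero_iff_shift) (auto simp: f_eq_g)
  moreover have "(\<lambda>k. f $ 0 * norm z ^ ?M * norm z ^ k) sums (f $ 0 * norm z ^ ?M * (1 / (1 - norm z)))"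
    using z by (intro sums_mult geometric_sums) simp
  moreover have "norm (?d (k + ?M)) \<le> f $ 0 * norm z ^ ?M * norm z ^ k" for k
  proof -
    have "norm (?d (k + ?M)) = \<bar>f $ (k + ?M) - g $ (k + ?M)\<bar> * (norm z ^ ?M * norm z ^ k)"
      by (simp only: norm_mult norm_power norm_of_real power_add abs_minus_commute[of "g $ _"] mult_ac)
    also have "\<dots> \<le> f $ 0 * (norm z ^ ?M * norm z ^ k)"
      by (intro mult_right_mono f_minus_g_bound) auto
    finally show ?thesis by (simp only: mult.assoc)
  qed
  ultimately have "norm (eval_fps (of_real_fps g) z - eval_fps (of_real_fps f) z)
      \<le> f $ 0 * norm z ^ ?M * (1 / (1 - norm z))"
    by (rule norm_sums_le)
  then show ?thesis by (simp add: quot)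
qed

end

section \<open>The hypergeometric case and uniform convergence\<close>

lemma of_real_fps_hyp_2F1:
  "of_real_fps (hyp_2F1_fps a 1 c) =
     (hyp_2F1_fps (of_real a) 1 (of_real c) :: 'a::{real_field, field_char_0} fps)"
  by (rule fps_ext) (simp add: hyp_2F1_fps_nth pochhammer_of_real flip: pochhammer_fact)

lemma map_poly_hyp_pade_denom:
  "map_poly of_real (hyp_pade_denom a c m n) =
     (hyp_pade_denom (of_real a) (of_real c) m n :: 'a::{real_field, field_char_0} poly)"
proof (rule poly_eqI)
  fix k
  have "of_real (pochhammer (- real n) k) = (pochhammer (- of_nat n) k :: 'a)"
    "of_real (pochhammer (- a - real m) k) = (pochhammer (- of_real a - of_nat m) k :: 'a)"
    "of_real (pochhammer (- c - real m - real n + 1) k) =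
      (pochhammer (- of_real c - of_nat m - of_nat n + 1) k :: 'a)"
    by (simp_all flip: pochhammer_of_real)
  then show "coeff (map_poly of_real (hyp_pade_denom a c m n)) k =
      (coeff (hyp_pade_denom (of_real a) (of_real c) m n) k :: 'a)"
    by (simp add: coeff_map_poly coeff_hyp_pade_denom)
qed

theorem theorem7:
  fixes a c \<rho> :: real
    and P Q :: "nat \<Rightarrow> nat \<Rightarrow> complex poly"
    and m n :: "nat \<Rightarrow> nat"
    and K :: "complex set"
  assumes not_neg_int: "\<forall>k::nat. 0 < k \<longrightarrow> a \<noteq> - real k \<and> c \<noteq> - real k \<and> c - a \<noteq> - real k"
    and ac: "c > a" "a > 0"
    and rho: "0 < \<rho>" "\<rho> \<le> 1"
    and pade: "\<And>M N. N \<le> M + 1 \<Longrightarrow>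
                 is_pade (hyp_2F1_fps (of_real a) 1 (of_real c)) M N (P M N) (Q M N)"
    and normalized: "\<And>M N. N \<le> M + 1 \<Longrightarrow> Q M N = hyp_pade_denom (of_real a) (of_real c) M N"
    and mn: "\<And>j. n j \<le> m j + 1"
    and m_lim: "filterlim m at_top sequentially"
    and ratio_lim: "(\<lambda>j. real (n j) / real (m j)) \<longlonglongrightarrow> \<rho>"
    and K: "compact K" "K \<subseteq> ball 0 1"
  shows "(\<forall>\<^sub>F j in sequentially. \<forall>z\<in>K. poly (Q (m j) (n j)) z \<noteq> 0) \<and>
         uniform_limit K (\<lambda>j z. poly (P (m j) (n j)) z / poly (Q (m j) (n j)) z)
           (\<lambda>z. hyp_2F1 (of_real a) 1 (of_real c) z) sequentially"
proof -
  define f where "f = hyp_2F1_fps a 1 c"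
  \<comment> \<open>The positivity argument needs real polynomials. The explicit real pair satisfies
    the approximation property, and its complex image is then identified with the given
    \<open>P\<close> and \<open>Q\<close>.\<close>
  define Pr where "Pr M N = truncate_fps (Suc M) (f * fps_of_poly (hyp_pade_denom a c M N))" for M N
  have f0: "f $ 0 = 1" by (simp add: f_def hyp_2F1_fps_nth)
  have loc: "moment_pade f M N (Pr M N) (hyp_pade_denom a c M N)" if "N \<le> M + 1" for M N
  proof
    show "moment_positive f" using ac by (simp add: f_def moment_positive_hyp_2F1)
    show "is_pade f M N (Pr M N) (hyp_pade_denom a c M N)"
      unfolding f_def Pr_def using ac that
      by (intro is_pade_hyp_pade_denom) (auto simp: pochhammer_eq_0_iff)
  qed (use that in \<open>auto simp: coeff_0_hyp_pade_denom\<close>)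
  have Q_eq: "Q M N = map_poly of_real (hyp_pade_denom a c M N)" if "N \<le> M + 1" for M N
    using normalized[OF that] by (simp add: map_poly_hyp_pade_denom)
  have P_eq: "P M N = map_poly of_real (Pr M N)" if "N \<le> M + 1" for M N
    using pade[OF that] moment_pade.P_unique[OF loc[OF that], of "P M N"] Q_eq[OF that]
    by (simp add: f_def of_real_fps_hyp_2F1)
  have nz: "poly (Q (m j) (n j)) z \<noteq> 0" if "z \<in> K" for j z
    using moment_pade.Q_nonzero[OF loc[OF mn[of j]], of z] K that by (auto simp: Q_eq[OF mn[of j]])
  have err: "norm (poly (P (m j) (n j)) z / poly (Q (m j) (n j)) z - hyp_2F1 (of_real a) 1 (of_real c) z)
      \<le> norm z ^ (m j + n j + 1) / (1 - norm z)" if "norm z < 1" for j z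
    using moment_pade.pade_error[OF loc[OF mn[of j]] that]
    by (simp add: f0 P_eq[OF mn[of j]] Q_eq[OF mn[of j]] hyp_2F1_def of_real_fps_hyp_2F1[symmetric] f_def[symmetric])
  \<comment> \<open>Compactness gives one radius below 1 for all of \<open>K\<close>, so the
    pointwise error bound becomes uniform.\<close>
  obtain r where r: "0 \<le> r" "r < 1" "\<And>z. z \<in> K \<Longrightarrow> norm z \<le> r"
  proof (cases "K = {}")
    case True
    then show ?thesis using that[of 0] by auto
  next
    case False
    obtain z0 where "z0 \<in> K" "\<And>z. z \<in> K \<Longrightarrow> norm z \<le> norm z0"
      using continuous_attains_sup[OF K(1) False, of norm] by (auto intro: continuous_intros)
    then show ?thesis using that[of "norm z0"] K(2) by auto
  qed
  have "(\<lambda>j. r ^ m j / (1 - r)) \<longlonglongrightarrow> 0 / (1 - r)"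
    using r by (intro tendsto_divide filterlim_compose[OF LIMSEQ_realpow_zero m_lim]) auto
  then have lim: "(\<lambda>j. r ^ m j / (1 - r)) \<longlonglongrightarrow> 0" by simp
  have "uniform_limit K (\<lambda>j z. poly (P (m j) (n j)) z / poly (Q (m j) (n j)) z)
           (\<lambda>z. hyp_2F1 (of_real a) 1 (of_real c) z) sequentially"
  proof (rule uniform_limitI)
    fix e :: real assume "e > 0"
    then have "\<forall>\<^sub>F j in sequentially. r ^ m j / (1 - r) < e"
      by (rule order_tendstoD(2)[OF lim])
    then show "\<forall>\<^sub>F j in sequentially. \<forall>z\<in>K.
        dist (poly (P (m j) (n j)) z / poly (Q (m j) (n j)) z) (hyp_2F1 (of_real a) 1 (of_real c) z) < e"
    proof (rule eventually_mono, intro ballI)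
      fix j z assume j: "r ^ m j / (1 - r) < e" and z: "z \<in> K"
      have "norm z ^ (m j + n j + 1) \<le> norm z ^ m j"
        using r(2) r(3)[OF z] by (intro power_decreasing) auto
      also have "\<dots> \<le> r ^ m j" using r(3)[OF z] by (intro power_mono) auto
      finally have "norm z ^ (m j + n j + 1) / (1 - norm z) \<le> r ^ m j / (1 - r)"
        using r(1,2) r(3)[OF z] by (intro frac_le) auto
      with j err[of z j] r(2) r(3)[OF z] show "dist (poly (P (m j) (n j)) z / poly (Q (m j) (n j)) z)
          (hyp_2F1 (of_real a) 1 (of_real c) z) < e"
        by (simp add: dist_norm)
    qed
  qed
  with nz show ?thesis by auto
qed

end
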